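(* Let $\Lambda\subseteq\mathbb{Z}_{\ge0}^k$ be a Young diagram of dimension $k$, let $B=\{b_\mu\in\mathbb{K}\mid\mu\in\mathrm{corn}(\Lambda)\}$ be a set of constants at least one of which is non-zero, and let $A_{\Lambda,B}$ be the associated local algebra. Then $A_{\Lambda,B}$ is Gorenstein if and only if the system of linear equations $$\sum_{\substack{\lambda\in\mathrm{precorn}(\Lambda)\\ \lambda+e_i\in\mathrm{corn}(\Lambda)}} b_{\lambda+e_i}z_\lambda=0,\qquad 1\le i\le k,$$ in the variables $z_\lambda$, $\lambda\in\mathrm{precorn}(\Lambda)$, has only the zero solution.
   Context: The base field $\mathbb{K}$ is algebraically closed of characteristic zero. Let $k\in\mathbb{Z}_{>0}$; $e_1,\ldots,e_k$ is the standard basis of $\mathbb{Z}^k$. On $\mathbb{Z}_{\ge0}^k$ consider the product order: $\lambda\preccurlyeq\mu$ means $\lambda_i\le\mu_i$ for all $i$. A Young diagram of dimension $k$ is a finite subset $\Lambda\subseteq\mathbb{Z}_{\ge0}^k$ such that $\mu\in\Lambda$, $\lambda\in\mathbb{Z}_{\ge 0}^k$ and $\lambda\preccurlyeq\mu$ imply $\lambda\in\Lambda$; it is assumed that for any $1\le i\le k$ there is $\lambda\in\Lambda$ with $\lambda_i\ne0$. Elements of $\Lambda$ are called cells. A corner cell is a maximal element of $\Lambda$ with respect to $\preccurlyeq$; the set of corner cells is $\mathrm{corn}(\Lambda)$. A non-corner cell $\lambda\in\Lambda$ is a precorner cell if for every $1\le i\le k$ either $\lambda+e_i\notin\Lambda$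 or $\lambda+e_i\in\mathrm{corn}(\Lambda)$; the set of precorner cells is $\mathrm{precorn}(\Lambda)$. Write $x^\lambda=x_1^{\lambda_1}\cdots x_k^{\lambda_k}$. The algebra $A_{\Lambda,B}$ is the quotient of $\mathbb{K}[x_1,\ldots,x_k]$ by the relations $x^\lambda=0$ for $\lambda\in\mathbb{Z}_{\ge0}^k\setminus\Lambda$ and $b_\nu x^\mu=b_\mu x^\nu$ for $\mu,\nu\in\mathrm{corn}(\Lambda)$. A local finite-dimensional algebra $A$ with maximal ideal $\mathfrak{m}$ is Gorenstein if its socle $\mathrm{Soc}\,A=\{a\in A\mid a\mathfrak{m}=0\}$ is one-dimensional. *)

theory Defs
  imports
    "HOL-Analysis.Finite_Cartesian_Product"
    "HOL-Library.Poly_Mapping"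
    "HOL-Computational_Algebra.Polynomial"
    "HOL-Algebra.QuotRing"
    "HOL-Algebra.Embedded_Algebras"
    "HOL-Algebra.Algebraic_Closure_Type"
begin

text \<open>
  Exponent vectors in $\mathbb{Z}_{\ge 0}^k$ are elements of \<open>nat ^ 'k\<close> with
  $k = $ \<open>CARD('k)\<close>; this is positive since types are non-empty. The library order on
  \<open>nat ^ 'k\<close> is the componentwise one, i.e. the product order.
\<close>

definition unit_exp :: "'k::finite \<Rightarrow> nat ^ 'k" where
  "unit_exp i = axis i 1"

definition young_diagram :: "(nat ^ 'k::finite) set \<Rightarrow> bool" where
  "young_diagram \<Lambda> \<longleftrightarrow>
     finite \<Lambda> \<and>
     (\<forall>\<mu>\<in>\<Lambda>. \<forall>\<alpha>. \<alpha> \<le> \<mu> \<longrightarrow> \<alpha> \<in> \<Lambda>) \<and>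
     (\<forall>i. \<exists>\<alpha>\<in>\<Lambda>. \<alpha> $ i \<noteq> 0)"

definition corn :: "(nat ^ 'k::finite) set \<Rightarrow> (nat ^ 'k) set" where
  "corn \<Lambda> = {\<alpha> \<in> \<Lambda>. \<forall>\<mu>\<in>\<Lambda>. \<alpha> \<le> \<mu> \<longrightarrow> \<mu> = \<alpha>}"

definition precorn :: "(nat ^ 'k::finite) set \<Rightarrow> (nat ^ 'k) set" where
  "precorn \<Lambda> = {\<alpha> \<in> \<Lambda>. \<alpha> \<notin> corn \<Lambda> \<and>
     (\<forall>i. \<alpha> + unit_exp i \<notin> \<Lambda> \<or> \<alpha> + unit_exp i \<in> corn \<Lambda>)}"

text \<open>
  The polynomial ring $K[x_1,\dots,x_k]$ is the monoid algebra of \<open>nat ^ 'k\<close>, i.e. the type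
  \<open>(nat ^ 'k) \<Rightarrow>\<^sub>0 'a\<close> of finitely supported coefficient functions with the convolution
  product; \<open>ring_of_type_algebra\<close> turns it into a ring record with full carrier.
\<close>

abbreviation mpoly_ring :: "((nat ^ 'k::finite) \<Rightarrow>\<^sub>0 'a::field) ring" where
  "mpoly_ring \<equiv> ring_of_type_algebra"

definition monomial :: "nat ^ 'k::finite \<Rightarrow> ((nat ^ 'k) \<Rightarrow>\<^sub>0 'a::field)" where
  "monomial \<alpha> = Poly_Mapping.single \<alpha> 1"

definition const_poly :: "'a::field \<Rightarrow> ((nat ^ 'k::finite) \<Rightarrow>\<^sub>0 'a)" where
  "const_poly c = Poly_Mapping.single 0 c"

text \<open>Only the values of \<open>b\<close> on \<open>corn \<Lambda>\<close> are used.\<close>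

definition diagram_ideal ::
    "(nat ^ 'k::finite) set \<Rightarrow> (nat ^ 'k \<Rightarrow> 'a::field) \<Rightarrow> ((nat ^ 'k) \<Rightarrow>\<^sub>0 'a) set" where
  "diagram_ideal \<Lambda> b = Idl\<^bsub>mpoly_ring\<^esub>
     ({monomial \<alpha> | \<alpha>. \<alpha> \<notin> \<Lambda>} \<union>
      {const_poly (b \<nu>) * monomial \<mu> - const_poly (b \<mu>) * monomial \<nu> | \<mu> \<nu>.
         \<mu> \<in> corn \<Lambda> \<and> \<nu> \<in> corn \<Lambda>})"

definition diagram_algebra ::
    "(nat ^ 'k::finite) set \<Rightarrow> (nat ^ 'k \<Rightarrow> 'a::field) \<Rightarrow> ((nat ^ 'k) \<Rightarrow>\<^sub>0 'a) set ring" where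
  "diagram_algebra \<Lambda> b = mpoly_ring Quot diagram_ideal \<Lambda> b"

text \<open>
  The image of the base field in the quotient, i.e. the classes of the constant polynomials.
  Dimensions over the base field are expressed as dimensions over this subfield.
\<close>

definition diagram_scalars ::
    "(nat ^ 'k::finite) set \<Rightarrow> (nat ^ 'k \<Rightarrow> 'a::field) \<Rightarrow> ((nat ^ 'k) \<Rightarrow>\<^sub>0 'a) set set" where
  "diagram_scalars \<Lambda> b = range (\<lambda>c. diagram_ideal \<Lambda> b +>\<^bsub>mpoly_ring\<^esub> const_poly c)"

definition local_algebra :: "'r set \<Rightarrow> ('r, 'm) ring_scheme \<Rightarrow> bool" where
  "local_algebra K A \<longleftrightarrow>
     cring A \<and> subfield K A \<and> ring.finite_dimension A K (carrier A) \<and> (\<exists>!M. maximalideal M A)"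

definition max_ideal :: "('r, 'm) ring_scheme \<Rightarrow> 'r set" where
  "max_ideal A = (THE M. maximalideal M A)"

definition socle :: "('r, 'm) ring_scheme \<Rightarrow> 'r set" where
  "socle A = {a \<in> carrier A. \<forall>m\<in>max_ideal A. a \<otimes>\<^bsub>A\<^esub> m = \<zero>\<^bsub>A\<^esub>}"

definition gorenstein :: "'r set \<Rightarrow> ('r, 'm) ring_scheme \<Rightarrow> bool" where
  "gorenstein K A \<longleftrightarrow> local_algebra K A \<and> ring.dimension A 1 K (socle A)"

end

theory Submission
  imports Defs
begin

text \<open>
  The defining ideal consists of the polynomials with no coefficients on non-corner cells on which
  the linear form $\sum_{\mu \in \mathrm{corn}(\Lambda)} b_\mu f_\mu$ vanishes. The maximal ideal is
  generated by the variables, so a class lies in the socle iff every $x_i f$ satisfies these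
  conditions. Comparing coefficients, $f$ must vanish on the cells that are neither corner nor
  precorner, and its precorner coefficients must solve the linear system, whereas the corner
  coefficients are free and contribute exactly one dimension modulo the ideal. Hence
  $\dim \mathrm{Soc}\,A$ is one plus the dimension of the solution space.
\<close>

abbreviation (input) lookup where "lookup \<equiv> Poly_Mapping.lookup"
abbreviation (input) single where "single \<equiv> Poly_Mapping.single"

section \<open>Monomials\<close>

text \<open>A polynomial is the sum of its terms, which gives an induction principle with the
  predicate coded as the set \<open>S\<close>. Only the terms of \<open>f\<close> itself have to lie
  in \<open>S\<close>, so facts about the support of \<open>f\<close> stay available.\<close>

lemma poly_mapping_mem_of_singles:
  fixes f :: "'m \<Rightarrow>\<^sub>0 'c::comm_monoid_add"
  assumes "0 \<in> S" and "\<And>g h. g \<in> S \<Longrightarrow> h \<in> S \<Longrightarrow> g + h \<in> S"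
    and "\<And>\<alpha>. \<alpha> \<in> Poly_Mapping.keys f \<Longrightarrow> single \<alpha> (lookup f \<alpha>) \<in> S"
  shows "f \<in> S"
proof -
  have "f = (\<Sum>\<alpha>\<in>Poly_Mapping.keys f. single \<alpha> (lookup f \<alpha>))"
    by (rule poly_mapping_eqI) (auto simp: lookup_sum lookup_single when_def in_keys_iff)
  also have "(\<Sum>\<alpha>\<in>A. single \<alpha> (lookup f \<alpha>)) \<in> S" if "A \<subseteq> Poly_Mapping.keys f" for A
    using that by (induct A rule: infinite_finite_induct) (auto intro: assms)
  finally show ?thesis by simp
qed

lemma vec_nat_le_iff_add: "\<alpha> \<le> \<gamma> \<longleftrightarrow> (\<exists>\<beta>. \<gamma> = \<alpha> + \<beta>)" for \<alpha> \<gamma> :: "nat ^ 'k::finite"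
proof
  assume "\<alpha> \<le> \<gamma>"
  then have "\<gamma> = \<alpha> + (\<gamma> - \<alpha>)"
    by (simp add: vec_eq_iff less_eq_vec_def)
  then show "\<exists>\<beta>. \<gamma> = \<alpha> + \<beta>" ..
qed (auto simp: less_eq_vec_def)

text \<open>Translation by \<open>\<alpha>\<close> is injective on exponents, so exactly one term of
  \<open>f\<close> contributes to this coefficient.\<close>

lemma lookup_single_mult_add:
  fixes f :: "(nat ^ 'k::finite) \<Rightarrow>\<^sub>0 'c::comm_semiring_1"
  shows "lookup (single \<alpha> c * f) (\<alpha> + \<beta>) = c * lookup f \<beta>"
proof -
  have "f \<in> {f. lookup (single \<alpha> c * f) (\<alpha> + \<beta>) = c * lookup f \<beta>}"
    by (rule poly_mapping_mem_of_singles)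
      (auto simp: lookup_add ring_distribs mult_single lookup_single when_def)
  then show ?thesis by simp
qed

lemma lookup_single_mult_not_le:
  fixes f :: "(nat ^ 'k::finite) \<Rightarrow>\<^sub>0 'c::comm_semiring_1"
  assumes "\<not> \<alpha> \<le> \<gamma>"
  shows "lookup (single \<alpha> c * f) \<gamma> = 0"
proof -
  have ne: "\<alpha> + \<beta> \<noteq> \<gamma>" for \<beta>
    using assms vec_nat_le_iff_add by blast
  have "f \<in> {f. lookup (single \<alpha> c * f) \<gamma> = 0}"
    by (rule poly_mapping_mem_of_singles)
      (auto simp: ne lookup_add ring_distribs mult_single lookup_single when_def)
  then show ?thesis by simp
qed

lemma unit_exp_le_iff: "unit_exp i \<le> \<alpha> \<longleftrightarrow> \<alpha> $ i \<noteq> 0"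
  by (simp add: unit_exp_def axis_def less_eq_vec_def if_distrib[of "\<lambda>x. x \<le> _"] Suc_le_eq cong: if_cong)

section \<open>Ideals in type-class notation\<close>

text \<open>Negation is multiplication by -1 and the ring is commutative, so closure under addition
  and one-sided multiplication already gives a two-sided ideal.\<close>

lemma ideal_ring_of_type_algebra_iff:
  fixes I :: "'r::comm_ring_1 set"
  shows "ideal I ring_of_type_algebra \<longleftrightarrow>
    0 \<in> I \<and> (\<forall>x\<in>I. \<forall>y\<in>I. x + y \<in> I) \<and> (\<forall>x\<in>I. \<forall>r. r * x \<in> I)"
    (is "?L \<longleftrightarrow> ?R")
proof
  assume ?L
  then have I: "additive_subgroup I (ring_of_type_algebra :: 'r ring)" by (rule ideal.axioms)
  note simps = ring_of_type_algebra_def ring.simps monoid.simps partial_object.simps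
  show ?R
    using additive_subgroup.zero_closed[OF I] additive_subgroup.a_closed[OF I]
      ideal.I_l_closed[OF \<open>?L\<close>] unfolding simps by blast
next
  assume R: ?R
  have ring: "ring (ring_of_type_algebra :: 'r ring)" by (rule ring_from_type_algebra)
  have minus: "\<ominus>\<^bsub>ring_of_type_algebra\<^esub> x = - x" for x :: 'r
    by (rule abelian_group.minus_equality[OF ring.is_abelian_group[OF ring]])
      (auto simp: ring_of_type_algebra_def)
  have neg: "- x \<in> I" if "x \<in> I" for x
    using R that by (metis mult_minus1)
  show ?L
  proof (rule idealI[OF ring])
    show "subgroup I (add_monoid (ring_of_type_algebra :: 'r ring))"
    proof
      show "inv\<^bsub>add_monoid ring_of_type_algebra\<^esub> x \<in> I" if "x \<in> I" for x
        using neg[OF that] minus unfolding a_inv_def by simp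
    qed (use R in \<open>auto simp: ring_of_type_algebra_def\<close>)
  next
    fix a x assume "a \<in> I"
    then have "x * a \<in> I" using R by blast
    then show "x \<otimes>\<^bsub>ring_of_type_algebra\<^esub> a \<in> I" "a \<otimes>\<^bsub>ring_of_type_algebra\<^esub> x \<in> I"
      by (simp_all add: ring_of_type_algebra_def mult.commute)
  qed
qed

section \<open>The relations of a diagram algebra\<close>

locale diagram =
  fixes \<Lambda> :: "(nat ^ 'k::finite) set" and b :: "nat ^ 'k \<Rightarrow> 'a::field"
  assumes young: "young_diagram \<Lambda>" and b_nonzero: "\<exists>\<mu>\<in>corn \<Lambda>. b \<mu> \<noteq> 0"
begin

text \<open>The linear functional that kills every corner relation; it detects which combinations of
  corner monomials become zero.\<close>

definition b_form :: "((nat ^ 'k) \<Rightarrow>\<^sub>0 'a) \<Rightarrow> 'a" where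
  "b_form f = (\<Sum>\<mu>\<in>corn \<Lambda>. b \<mu> * lookup f \<mu>)"

lemma finite_diagram: "finite \<Lambda>" and finite_corn: "finite (corn \<Lambda>)"
  using young by (auto simp: young_diagram_def corn_def)

lemma diagram_down: "\<mu> \<in> \<Lambda> \<Longrightarrow> \<alpha> \<le> \<mu> \<Longrightarrow> \<alpha> \<in> \<Lambda>"
  using young unfolding young_diagram_def by blast

lemma diagram_add_left: "\<alpha> + \<beta> \<in> \<Lambda> \<Longrightarrow> \<beta> \<in> \<Lambda>"
  by (erule diagram_down) (simp add: less_eq_vec_def)

lemma corn_add_notin: "\<mu> \<in> corn \<Lambda> \<Longrightarrow> \<alpha> \<noteq> 0 \<Longrightarrow> \<alpha> + \<mu> \<notin> \<Lambda>"
proof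
  assume "\<mu> \<in> corn \<Lambda>" "\<alpha> + \<mu> \<in> \<Lambda>"
  moreover have "\<mu> \<le> \<alpha> + \<mu>" by (simp add: less_eq_vec_def)
  ultimately have "\<alpha> + \<mu> = \<mu>" unfolding corn_def by blast
  moreover assume "\<alpha> \<noteq> 0"
  ultimately show False by simp
qed

lemma unit_exp_mem: "unit_exp i \<in> \<Lambda>"
proof -
  obtain \<mu> where "\<mu> \<in> \<Lambda>" "\<mu> $ i \<noteq> 0"
    using young unfolding young_diagram_def by blast
  then show ?thesis using diagram_down unit_exp_le_iff by blast
qed

lemma zero_mem: "0 \<in> \<Lambda>"
  using unit_exp_mem by (rule diagram_down) (simp add: less_eq_vec_def)

text \<open>All unit vectors are cells and there is at least one coordinate, so the origin is not
  maximal. This keeps constants nonzero in the quotient.\<close>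

lemma zero_not_corn: "0 \<notin> corn \<Lambda>"
  using corn_add_notin[of 0 "unit_exp i" for i] unit_exp_mem
  by (auto simp: unit_exp_def axis_eq_0_iff)

lemma b_form_add: "b_form (f + g) = b_form f + b_form g"
  by (simp add: b_form_def lookup_add ring_distribs sum.distrib)

lemma b_form_single: "b_form (single \<alpha> c) = (if \<alpha> \<in> corn \<Lambda> then b \<alpha> * c else 0)"
  using finite_corn by (simp add: b_form_def lookup_single when_def if_distrib cong: if_cong)

section \<open>Membership in the defining ideal\<close>

lemma diagram_ideal_eq:
  "diagram_ideal \<Lambda> b = {f. (\<forall>\<alpha>\<in>\<Lambda> - corn \<Lambda>. lookup f \<alpha> = 0) \<and> b_form f = 0}"
    (is "_ = ?J")
proof -
  let ?P = "mpoly_ring :: ((nat ^ 'k) \<Rightarrow>\<^sub>0 'a) ring"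
  let ?G = "{monomial \<alpha> | \<alpha>. \<alpha> \<notin> \<Lambda>} \<union>
      {const_poly (b \<nu>) * monomial \<mu> - const_poly (b \<mu>) * monomial \<nu> | \<mu> \<nu>.
         \<mu> \<in> corn \<Lambda> \<and> \<nu> \<in> corn \<Lambda>}"
  interpret P: ring ?P by (rule ring_from_type_algebra)
  have corn_sub: "corn \<Lambda> \<subseteq> \<Lambda>" by (auto simp: corn_def)
  have carr: "?G \<subseteq> carrier ?P" by (simp add: ring_of_type_algebra_def)
  have G_eq: "const_poly (b \<nu>) * monomial \<mu> - const_poly (b \<mu>) * monomial \<nu>
      = single \<mu> (b \<nu>) + single \<nu> (- b \<mu>)" for \<mu> \<nu>
    by (simp add: const_poly_def monomial_def mult_single single_uminus)
  have mult: "single \<alpha> c * f \<in> ?J" if f: "f \<in> ?J" for \<alpha> c f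
  proof (cases "\<alpha> = 0")
    case True
    have "lookup (single 0 c * f) \<beta> = c * lookup f \<beta>" for \<beta>
      using lookup_single_mult_add[of 0 c f \<beta>] by simp
    then show ?thesis using f True
      by (simp add: b_form_def mult.left_commute flip: sum_distrib_left)
  next
    case False
    \<comment> \<open>A nonconstant factor shifts exponents strictly upwards: the coefficient at a
      cell \<open>\<gamma>\<close> comes from a cell below it, which cannot be a corner, and there
      \<open>f\<close> vanishes.\<close>
    have "lookup (single \<alpha> c * f) \<gamma> = 0" if "\<gamma> \<in> \<Lambda>" for \<gamma>
    proof (cases "\<alpha> \<le> \<gamma>")
      case True
      then obtain \<beta> where \<gamma>: "\<gamma> = \<alpha> + \<beta>" by (auto simp: vec_nat_le_iff_add)
      then have "\<beta> \<in> \<Lambda> - corn \<Lambda>"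
        using that diagram_add_left corn_add_notin[OF _ False] by auto
      then show ?thesis using f \<gamma> by (simp add: lookup_single_mult_add)
    qed (simp add: lookup_single_mult_not_le)
    then show ?thesis using corn_sub by (auto simp: b_form_def intro!: sum.neutral)
  qed
  have add: "f + g \<in> ?J" if "f \<in> ?J" "g \<in> ?J" for f g
    using that by (simp add: lookup_add b_form_add)
  have zero: "0 \<in> ?J" by (simp add: b_form_def)
  have "g * f \<in> ?J" if f: "f \<in> ?J" for f g
  proof -
    have "g \<in> {g. g * f \<in> ?J}"
    proof (rule poly_mapping_mem_of_singles)
      show "0 \<in> {g. g * f \<in> ?J}" using zero by simp
      fix g h assume "g \<in> {g. g * f \<in> ?J}" "h \<in> {g. g * f \<in> ?J}"
      then show "g + h \<in> {g. g * f \<in> ?J}" 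
        using add[of "g * f" "h * f"] by (simp add: ring_distribs)
    qed (use mult[OF f] in simp)
    then show ?thesis by simp
  qed
  then have J: "ideal ?J ?P"
    unfolding ideal_ring_of_type_algebra_iff using zero add by blast
  have I: "ideal (diagram_ideal \<Lambda> b) ?P"
    unfolding diagram_ideal_def by (rule P.genideal_ideal[OF carr])
  have gen: "g \<in> diagram_ideal \<Lambda> b" if "g \<in> ?G" for g
    using P.genideal_self[OF carr] that unfolding diagram_ideal_def by blast
  note I_zero = I[unfolded ideal_ring_of_type_algebra_iff, THEN conjunct1]
    and I_add = I[unfolded ideal_ring_of_type_algebra_iff, THEN conjunct2, THEN conjunct1, rule_format]
    and I_mult = I[unfolded ideal_ring_of_type_algebra_iff, THEN conjunct2, THEN conjunct2, rule_format]
  show ?thesis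
  proof (rule subset_antisym)
    have "?G \<subseteq> ?J"
      unfolding G_eq using corn_sub
      by (auto simp: monomial_def lookup_add lookup_single when_def b_form_add b_form_single)
    then show "diagram_ideal \<Lambda> b \<subseteq> ?J"
      unfolding diagram_ideal_def by (rule P.genideal_minimal[OF J])
  next
    from b_nonzero obtain \<nu> where \<nu>: "\<nu> \<in> corn \<Lambda>" "b \<nu> \<noteq> 0" by blast
    \<comment> \<open>Each relation lets one trade a corner monomial for a multiple of the \<open>\<nu>\<close>-th one, so \<open>T f\<close>
      lies in the ideal whenever \<open>f\<close> is supported on corners and outside the diagram.\<close>
    define T where "T f = f + single \<nu> (- (b_form f / b \<nu>))" for f
    show "?J \<subseteq> diagram_ideal \<Lambda> b"
    proof
      fix f assume f: "f \<in> ?J"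
      have "f \<in> {f. T f \<in> diagram_ideal \<Lambda> b}"
      proof (rule poly_mapping_mem_of_singles)
        show "0 \<in> {f. T f \<in> diagram_ideal \<Lambda> b}"
          using I_zero by (simp add: T_def b_form_def)
      next
        fix g h assume "g \<in> {f. T f \<in> diagram_ideal \<Lambda> b}" "h \<in> {f. T f \<in> diagram_ideal \<Lambda> b}"
        moreover have "T (g + h) = T g + T h"
        proof -
          have "- (b_form (g + h) / b \<nu>) = - (b_form g / b \<nu>) + - (b_form h / b \<nu>)"
            by (simp add: b_form_add add_divide_distrib)
          then show ?thesis by (simp only: T_def single_add ac_simps)
        qed
        ultimately show "g + h \<in> {f. T f \<in> diagram_ideal \<Lambda> b}"
          using I_add by simp
      next
        fix \<alpha> assume \<alpha>: "\<alpha> \<in> Poly_Mapping.keys f"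
        define c where "c = lookup f \<alpha>"
        show "single \<alpha> (lookup f \<alpha>) \<in> {f. T f \<in> diagram_ideal \<Lambda> b}"
          unfolding c_def[symmetric]
        proof (cases "\<alpha> \<in> corn \<Lambda>")
          case True
          \<comment> \<open>This is the relation between \<open>\<alpha>\<close> and
            \<open>\<nu>\<close>, scaled by \<open>c / b \<nu>\<close>; for
            \<open>\<alpha> = \<nu>\<close> both sides are 0.\<close>
          have "T (single \<alpha> c) = single 0 (c / b \<nu>) * (single \<alpha> (b \<nu>) + single \<nu> (- b \<alpha>))"
            using \<nu> True by (simp add: T_def b_form_single ring_distribs mult_single mult.commute)
          moreover have "single \<alpha> (b \<nu>) + single \<nu> (- b \<alpha>) \<in> ?G"
            using True \<nu> unfolding G_eq[symmetric] by blast
          ultimately show "single \<alpha> c \<in> {f. T f \<in> diagram_ideal \<Lambda> b}"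
            using I_mult gen by simp
        next
          case False
          \<comment> \<open>Since \<open>f\<close> vanishes at non-corner cells, a non-corner
            exponent in its support lies outside the diagram, and its monomial is itself a
            generator.\<close>
          with \<alpha> f have "\<alpha> \<notin> \<Lambda>" by (auto simp: in_keys_iff)
          then have "monomial \<alpha> \<in> ?G" by blast
          moreover have "T (single \<alpha> c) = single 0 c * monomial \<alpha>"
            using False by (simp add: T_def b_form_single monomial_def mult_single)
          ultimately show "single \<alpha> c \<in> {f. T f \<in> diagram_ideal \<Lambda> b}"
            using I_mult gen by simp
        qed
      qed
      moreover have "T f = f" using f by (simp add: T_def)
      ultimately show "f \<in> diagram_ideal \<Lambda> b" by simp
    qed
  qed
qed

section \<open>The quotient\<close>

abbreviation P where "P \<equiv> (mpoly_ring :: ((nat ^ 'k) \<Rightarrow>\<^sub>0 'a) ring)"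
abbreviation I where "I \<equiv> diagram_ideal \<Lambda> b"
abbreviation A where "A \<equiv> diagram_algebra \<Lambda> b"
abbreviation K where "K \<equiv> diagram_scalars \<Lambda> b"

definition cls :: "((nat ^ 'k) \<Rightarrow>\<^sub>0 'a) \<Rightarrow> ((nat ^ 'k) \<Rightarrow>\<^sub>0 'a) set" where
  "cls f = I +>\<^bsub>P\<^esub> f"

lemma ideal_diagram_ideal: "ideal I P"
  unfolding diagram_ideal_def
  by (rule ring.genideal_ideal[OF ring_from_type_algebra]) (simp add: ring_of_type_algebra_def)

lemma cring_A: "cring A"
  unfolding diagram_algebra_def
  by (rule ideal.quotient_is_cring[OF ideal_diagram_ideal cring_from_type_algebra])

lemma cls_hom: "cls \<in> ring_hom P A"
  using ideal.rcos_ring_hom[OF ideal_diagram_ideal] unfolding diagram_algebra_def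
  by (simp add: cls_def[abs_def])

lemma carrier_A: "carrier A = range cls"
  by (auto simp: diagram_algebra_def FactRing_def A_RCOSETS_def' cls_def ring_of_type_algebra_def)

lemma
  cls_add: "cls f \<oplus>\<^bsub>A\<^esub> cls g = cls (f + g)" and
  cls_mult: "cls f \<otimes>\<^bsub>A\<^esub> cls g = cls (f * g)" and
  cls_one: "\<one>\<^bsub>A\<^esub> = cls 1"
  using ring_hom_add[OF cls_hom, of f g] ring_hom_mult[OF cls_hom, of f g] ring_hom_one[OF cls_hom]
  by (simp_all add: ring_of_type_algebra_def)

lemma cls_zero: "\<zero>\<^bsub>A\<^esub> = cls 0"
  using ring_hom_zero[OF cls_hom ring_from_type_algebra cring.axioms(1)[OF cring_A]]
  by (simp add: ring_of_type_algebra_def)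

lemma cls_eq_iff: "cls f = cls g \<longleftrightarrow> f - g \<in> I"
proof -
  interpret P: ring P by (rule ring_from_type_algebra)
  have "\<ominus>\<^bsub>P\<^esub> g = - g"
    by (rule P.minus_equality) (auto simp: ring_of_type_algebra_def)
  then have "f \<ominus>\<^bsub>P\<^esub> g = f - g"
    by (simp add: a_minus_def) (simp add: ring_of_type_algebra_def)
  then show ?thesis
    using P.quotient_eq_iff_same_a_r_cos[OF ideal_diagram_ideal, of f g]
    by (simp add: cls_def ring_of_type_algebra_def)
qed

lemma cls_eq_zero_iff: "cls f = \<zero>\<^bsub>A\<^esub> \<longleftrightarrow> f \<in> I"
  by (simp add: cls_zero cls_eq_iff)

lemma mem_I_iff: "f \<in> I \<longleftrightarrow> (\<forall>\<alpha>\<in>\<Lambda> - corn \<Lambda>. lookup f \<alpha> = 0) \<and> b_form f = 0"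
  by (simp add: diagram_ideal_eq)

text \<open>The origin is a non-corner cell. Consequently the constant coefficient depends only on
  the residue class.\<close>

lemma I_coef_zero: "f \<in> I \<Longrightarrow> lookup f 0 = 0"
  using zero_mem zero_not_corn by (auto simp: mem_I_iff)

lemma scalars_eq: "K = range (\<lambda>c. cls (const_poly c))"
  by (simp add: diagram_scalars_def cls_def)

lemma coef_const_mult: "lookup (const_poly c * f) \<alpha> = c * lookup f \<alpha>"
  using lookup_single_mult_add[of 0 c f \<alpha>] by (simp add: const_poly_def)

section \<open>Scalars and finite dimension\<close>

text \<open>The scalars are the image of a field under a homomorphism to a nonzero ring; 1 survives
  because members of the ideal have no constant term.\<close>

lemma subfield_scalars: "subfield K A"
proof -
  let ?F = "ring_of_type_algebra :: 'a ring"
  have F: "field ?F" by (rule field_from_type_algebra)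
  interpret F: field ?F by (rule F)
  interpret A: cring A by (rule cring_A)
  have hom: "(\<lambda>c. cls (const_poly c)) \<in> ring_hom ?F A"
  proof (rule ring_hom_memI)
    fix x y :: 'a
    show "cls (const_poly x) \<in> carrier A" by (simp add: carrier_A)
    show "cls (const_poly (x \<otimes>\<^bsub>?F\<^esub> y)) = cls (const_poly x) \<otimes>\<^bsub>A\<^esub> cls (const_poly y)"
      by (simp add: cls_mult const_poly_def mult_single ring_of_type_algebra_def)
    show "cls (const_poly (x \<oplus>\<^bsub>?F\<^esub> y)) = cls (const_poly x) \<oplus>\<^bsub>A\<^esub> cls (const_poly y)"
      by (simp add: cls_add const_poly_def single_add ring_of_type_algebra_def)
    show "cls (const_poly \<one>\<^bsub>?F\<^esub>) = \<one>\<^bsub>A\<^esub>"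
      by (simp add: cls_one const_poly_def ring_of_type_algebra_def)
  qed
  have hom_ring: "ring_hom_ring ?F A (\<lambda>c. cls (const_poly c))"
    by (rule ring_hom_ringI2[OF F.ring_axioms A.ring_axioms hom])
  have "1 \<notin> I" using I_coef_zero[of 1] by auto
  then have "\<one>\<^bsub>A\<^esub> \<noteq> \<zero>\<^bsub>A\<^esub>" by (simp add: cls_one cls_eq_zero_iff)
  then have "subfield ((\<lambda>c. cls (const_poly c)) ` carrier ?F) A"
    by (rule ring_hom_ring.img_is_subfield(2)[OF hom_ring F.carrier_is_subfield])
  then show ?thesis by (simp add: scalars_eq ring_of_type_algebra_def)
qed

text \<open>The classes of the finitely many monomials with exponent in \<open>\<Lambda>\<close>
  span, because all other monomials vanish.\<close>

lemma finite_dimension_A: "ring.finite_dimension A K (carrier A)"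
proof -
  interpret A: cring A by (rule cring_A)
  obtain L where L: "set L = \<Lambda>" using finite_list[OF finite_diagram] ..
  let ?U = "map (\<lambda>\<alpha>. cls (monomial \<alpha>)) L"
  have U: "set ?U \<subseteq> carrier A" by (auto simp: carrier_A)
  note props = A.Span_subgroup_props[OF subfield_scalars U]
  have "cls f \<in> A.Span K ?U" for f
  proof -
    have "f \<in> {f. cls f \<in> A.Span K ?U}"
    proof (rule poly_mapping_mem_of_singles)
      show "0 \<in> {f. cls f \<in> A.Span K ?U}"
        using props(2) unfolding cls_zero by simp
    next
      fix g h assume "g \<in> {f. cls f \<in> A.Span K ?U}" "h \<in> {f. cls f \<in> A.Span K ?U}"
      then show "g + h \<in> {f. cls f \<in> A.Span K ?U}"
        using props(3)[of "cls g" "cls h"] unfolding cls_add by simp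
    next
      fix \<alpha>
      define c where "c = lookup f \<alpha>"
      have single: "single \<alpha> c = const_poly c * monomial \<alpha>"
        by (simp add: const_poly_def monomial_def mult_single)
      have "cls (single \<alpha> c) \<in> A.Span K ?U"
      proof (cases "\<alpha> \<in> \<Lambda>")
        case True
        then have "cls (monomial \<alpha>) \<in> A.Span K ?U"
          using A.Span_base_incl[OF subfield_scalars U] L by auto
        then have "cls (const_poly c) \<otimes>\<^bsub>A\<^esub> cls (monomial \<alpha>) \<in> A.Span K ?U"
          by (intro A.Span_smult_closed[OF subfield_scalars U]) (auto simp: scalars_eq)
        then show ?thesis by (simp only: cls_mult single)
      next
        case False
        then have "single \<alpha> c \<in> I"
          by (auto simp: mem_I_iff b_form_single lookup_single when_def corn_def)
        then show ?thesis using props(2) cls_eq_zero_iff by metis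
      qed
      then show "single \<alpha> (lookup f \<alpha>) \<in> {f. cls f \<in> A.Span K ?U}"
        by (simp add: c_def)
    qed
    then show ?thesis by simp
  qed
  then have "carrier A = A.Span K ?U" using props(1) carrier_A by auto
  then show ?thesis using A.Span_finite_dimension[OF subfield_scalars U] by simp
qed

section \<open>The unique maximal ideal\<close>

text \<open>Pulls an ideal of the quotient back to polynomials, in the closure form that the
  induction principles for polynomials ask for.\<close>

lemma ideal_vimage_cls:
  assumes "ideal N A"
  shows "0 \<in> {f. cls f \<in> N}"
    and "\<And>f g. cls f \<in> N \<Longrightarrow> cls g \<in> N \<Longrightarrow> cls (f + g) \<in> N"
    and "\<And>f g. cls f \<in> N \<Longrightarrow> cls (g * f) \<in> N"
proof -
  have "additive_subgroup N A" using assms by (rule ideal.axioms)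
  note sub = additive_subgroup.zero_closed[OF this] additive_subgroup.a_closed[OF this]
  show "0 \<in> {f. cls f \<in> N}" using sub(1) by (simp add: cls_zero)
  show "cls (f + g) \<in> N" if "cls f \<in> N" "cls g \<in> N" for f g
    using sub(2)[OF that] by (simp add: cls_add)
  show "cls (g * f) \<in> N" if "cls f \<in> N" for f g
    using ideal.I_l_closed[OF assms that, of "cls g"] by (simp add: cls_mult carrier_A)
qed

text \<open>Every nonconstant term is divisible by some variable, so the variables generate the
  ideal of polynomials without constant term.\<close>

lemma mem_of_variables:
  fixes f :: "(nat ^ 'k) \<Rightarrow>\<^sub>0 'a"
  assumes zero: "0 \<in> S" and add: "\<And>g h. g \<in> S \<Longrightarrow> h \<in> S \<Longrightarrow> g + h \<in> S"
    and mult: "\<And>g h. h \<in> S \<Longrightarrow> g * h \<in> S" and var: "\<And>i. monomial (unit_exp i) \<in> S"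
    and f: "lookup f 0 = 0"
  shows "f \<in> S"
proof (rule poly_mapping_mem_of_singles[OF zero add])
  fix \<alpha> assume "\<alpha> \<in> Poly_Mapping.keys f"
  with f have "\<alpha> \<noteq> 0" by (auto simp: in_keys_iff)
  then obtain i where "\<alpha> $ i \<noteq> 0" by (auto simp: vec_eq_iff)
  then obtain \<beta> where \<alpha>: "\<alpha> = unit_exp i + \<beta>"
    unfolding unit_exp_le_iff[symmetric] vec_nat_le_iff_add ..
  have "single \<alpha> (lookup f \<alpha>) = single \<beta> (lookup f \<alpha>) * monomial (unit_exp i)"
    by (simp add: \<alpha> monomial_def mult_single add.commute)
  then show "single \<alpha> (lookup f \<alpha>) \<in> S" using mult[OF var] by simp
qed

text \<open>Image of the augmentation ideal, the kernel of evaluation at the origin.\<close>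

definition M0 :: "((nat ^ 'k) \<Rightarrow>\<^sub>0 'a) set set" where
  "M0 = cls ` {f. lookup f 0 = 0}"

text \<open>Evaluation at the origin is multiplicative: a nonconstant term of \<open>f\<close>
  contributes nothing to the constant coefficient of the product.\<close>

lemma coef_mult_zero: "lookup (f * g) 0 = lookup f 0 * lookup g 0" for f g :: "(nat ^ 'k) \<Rightarrow>\<^sub>0 'a"
proof -
  have "f \<in> {f. lookup (f * g) 0 = lookup f 0 * lookup g 0}"
  proof (rule poly_mapping_mem_of_singles)
    fix \<alpha>
    show "single \<alpha> (lookup f \<alpha>) \<in> {f. lookup (f * g) 0 = lookup f 0 * lookup g 0}"
    proof (cases "\<alpha> = 0")
      case True
      then show ?thesis using lookup_single_mult_add[of 0 "lookup f 0" g 0] by simp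
    next
      case False
      then have "\<not> \<alpha> \<le> 0" by (simp add: less_eq_vec_def vec_eq_iff)
      then show ?thesis using False by (simp add: lookup_single_mult_not_le lookup_single)
    qed
  qed (auto simp: lookup_add ring_distribs)
  then show ?thesis by simp
qed

lemma cls_mem_M0_iff: "cls f \<in> M0 \<longleftrightarrow> lookup f 0 = 0"
proof
  assume "cls f \<in> M0"
  then obtain g where "lookup g 0 = 0" "cls f = cls g" by (auto simp: M0_def)
  then show "lookup f 0 = 0" using I_coef_zero[of "f - g"] by (simp add: cls_eq_iff lookup_minus)
qed (simp add: M0_def)

lemma ideal_M0: "ideal M0 A"
proof -
  have "ideal {f :: (nat ^ 'k) \<Rightarrow>\<^sub>0 'a. lookup f 0 = 0} P"
    unfolding ideal_ring_of_type_algebra_iff by (auto simp: lookup_add coef_mult_zero)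
  from ring.ring_ideal_imp_quot_ideal[OF ring_from_type_algebra ideal_diagram_ideal this]
  show ?thesis by (simp add: diagram_algebra_def M0_def cls_def[abs_def])
qed

lemma one_mem_ideal_A:
  assumes "ideal N A" "cls 1 \<in> N"
  shows "N = carrier A"
  using ideal.one_imp_carrier[OF assms(1)] assms(2) by (simp add: cls_one)

text \<open>An element outside \<open>M0\<close> can be scaled to constant term 1 and then differs
  from 1 by an element of \<open>M0\<close>; an ideal containing both is everything.\<close>

lemma maximalideal_M0: "maximalideal M0 A"
proof (rule maximalidealI[OF ideal_M0])
  have "cls 1 \<notin> M0" by (simp add: cls_mem_M0_iff)
  then show "carrier A \<noteq> M0" by (auto simp: carrier_A)
next
  fix N assume N: "ideal N A" and sub: "M0 \<subseteq> N" "N \<subseteq> carrier A"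
  note closed = ideal_vimage_cls[OF N]
  show "N = M0 \<or> N = carrier A"
  proof (cases "N \<subseteq> M0")
    case False
    then obtain a where "a \<in> N" "a \<notin> M0" by blast
    then obtain f where f: "cls f \<in> N" "lookup f 0 \<noteq> 0"
      using sub(2) unfolding carrier_A by (auto simp: cls_mem_M0_iff)
    define g where "g = const_poly (1 / lookup f 0) * f"
    have "lookup (1 - g) 0 = 0"
      using f(2) by (simp add: g_def lookup_minus coef_const_mult)
    then have "cls (1 - g) \<in> N" using sub(1) cls_mem_M0_iff by blast
    moreover have "cls g \<in> N" unfolding g_def using closed(3)[OF f(1)] .
    ultimately have "cls (1 - g + g) \<in> N" by (rule closed(2))
    then show ?thesis using one_mem_ideal_A[OF N] by simp
  qed (use sub in auto)
qed

text \<open>The diagram is finite, so each variable is nilpotent in the quotient and lies in every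
  prime ideal. A maximal ideal therefore contains \<open>M0\<close>, and maximality of
  \<open>M0\<close> gives equality.\<close>

lemma maximalideal_eq_M0:
  assumes M: "maximalideal M A"
  shows "M = M0"
proof -
  interpret A: cring A by (rule cring_A)
  have ideal: "ideal M A" using M by (rule maximalideal.axioms)
  note closed = ideal_vimage_cls[OF ideal]
  have prime: "primeideal M A" using A.maximalideal_prime[OF M] .
  have one: "cls 1 \<notin> M"
    using one_mem_ideal_A[OF ideal] maximalideal.I_notcarr[OF M] by auto
  have var: "cls (monomial (unit_exp i)) \<in> M" for i
  proof -
    \<comment> \<open>The powers of x_i have infinitely many exponents, so one of them falls outside
      \<open>\<Lambda>\<close>.\<close>
    have "inj (axis i :: nat \<Rightarrow> nat ^ 'k)" by (simp add: inj_def axis_eq_axis)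
    then have "infinite (range (axis i :: nat \<Rightarrow> nat ^ 'k))" by (rule range_inj_infinite)
    then have "\<not> range (axis i) \<subseteq> \<Lambda>" using finite_diagram finite_subset by blast
    then obtain n where n: "axis i n \<notin> \<Lambda>" by blast
    then have "monomial (axis i n) \<in> I"
      by (auto simp: mem_I_iff monomial_def b_form_single lookup_single when_def corn_def)
    then have "cls (monomial (axis i n)) = cls 0" by (simp add: cls_eq_iff)
    then have "cls (monomial (axis i n)) \<in> M" using closed(1) by simp
    then show ?thesis
    \<comment> \<open>Primeness strips off one factor x_i at a time; the exponent cannot drop to 0,
      as that would put 1 into \<open>M\<close>.\<close>
    proof (induct n)
      case 0
      have "monomial (axis i 0 :: nat ^ 'k) = (1 :: (nat ^ 'k) \<Rightarrow>\<^sub>0 'a)"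
        by (simp add: monomial_def axis_def flip: zero_vec_def)
      with 0 one show ?case by simp
    next
      case (Suc n)
      have "axis i (Suc n) = unit_exp i + axis i n"
        by (simp add: unit_exp_def vec_eq_iff axis_def)
      then have "monomial (axis i (Suc n)) =
          (monomial (unit_exp i) * monomial (axis i n) :: (nat ^ 'k) \<Rightarrow>\<^sub>0 'a)"
        by (simp add: monomial_def mult_single)
      then have "cls (monomial (unit_exp i)) \<otimes>\<^bsub>A\<^esub> cls (monomial (axis i n)) \<in> M"
        using Suc.prems by (simp add: cls_mult)
      then show ?case
        using primeideal.I_prime[OF prime] Suc.hyps carrier_A by blast
    qed
  qed
  have "cls f \<in> M" if "lookup f 0 = 0" for f
  proof -
    have "f \<in> {f. cls f \<in> M}"
      by (rule mem_of_variables[OF closed(1) _ _ _ that]) (simp_all add: closed var)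
    then show ?thesis by simp
  qed
  then have "M0 \<subseteq> M" by (auto simp: M0_def)
  moreover have "M \<subseteq> carrier A" "M \<noteq> carrier A"
    using ideal.Icarr[OF ideal] maximalideal.I_notcarr[OF M] by auto
  ultimately show ?thesis using maximalideal.I_maximal[OF maximalideal_M0 ideal] by blast
qed

lemma local_algebra_A: "local_algebra K A"
  unfolding local_algebra_def
  using cring_A subfield_scalars finite_dimension_A maximalideal_M0 maximalideal_eq_M0 by blast

lemma max_ideal_A: "max_ideal A = M0"
  unfolding max_ideal_def
  using maximalideal_M0 maximalideal_eq_M0 by (rule the_equality)

section \<open>The socle\<close>

text \<open>Left-hand side of the \<open>i\<close>-th equation of the linear system.\<close>

definition precorn_form :: "'k \<Rightarrow> (nat ^ 'k \<Rightarrow> 'a) \<Rightarrow> 'a" where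
  "precorn_form i z =
    (\<Sum>\<alpha> | \<alpha> \<in> precorn \<Lambda> \<and> \<alpha> + unit_exp i \<in> corn \<Lambda>. b (\<alpha> + unit_exp i) * z \<alpha>)"

text \<open>Expresses, in coefficients of a representative, that every variable annihilates the
  class.\<close>

definition socle_poly :: "((nat ^ 'k) \<Rightarrow>\<^sub>0 'a) \<Rightarrow> bool" where
  "socle_poly f \<longleftrightarrow> (\<forall>\<alpha>\<in>\<Lambda> - corn \<Lambda> - precorn \<Lambda>. lookup f \<alpha> = 0) \<and>
     (\<forall>i. precorn_form i (lookup f) = 0)"

lemma unit_exp_neq_zero: "unit_exp i \<noteq> 0"
  by (simp add: unit_exp_def axis_eq_0_iff)

text \<open>A corner contributes only if its monomial is divisible by x_i; removing that factor
  reindexes the sum by the cell one step below the corner.\<close>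

lemma b_form_variable_mult:
  "b_form (monomial (unit_exp i) * f) =
    (\<Sum>\<beta> | \<beta> + unit_exp i \<in> corn \<Lambda>. b (\<beta> + unit_exp i) * lookup f \<beta>)"
proof -
  let ?B = "{\<beta>. \<beta> + unit_exp i \<in> corn \<Lambda>}"
  have img: "(\<lambda>\<beta>. \<beta> + unit_exp i) ` ?B = {\<mu> \<in> corn \<Lambda>. unit_exp i \<le> \<mu>}"
    by (auto simp: vec_nat_le_iff_add add.commute image_iff)
  have "b_form (monomial (unit_exp i) * f) =
      (\<Sum>\<mu>\<in>{\<mu> \<in> corn \<Lambda>. unit_exp i \<le> \<mu>}. b \<mu> * lookup (monomial (unit_exp i) * f) \<mu>)"
    unfolding b_form_def monomial_def
    by (rule sum.mono_neutral_right[OF finite_corn]) (auto simp: lookup_single_mult_not_le)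
  also have "\<dots> = (\<Sum>\<beta>\<in>?B. b (\<beta> + unit_exp i) * lookup (monomial (unit_exp i) * f) (\<beta> + unit_exp i))"
    unfolding img[symmetric] by (subst sum.reindex) (auto simp: inj_on_def)
  also have "\<dots> = (\<Sum>\<beta>\<in>?B. b (\<beta> + unit_exp i) * lookup f \<beta>)"
    unfolding monomial_def by (subst (2) add.commute, subst lookup_single_mult_add) simp
  finally show ?thesis .
qed

text \<open>The two conditions defining the ideal are tested separately: vanishing at non-corner
  cells kills the coefficients of \<open>f\<close> outside corners and precorners, and the corner
  functional then yields the linear system.\<close>

lemma variable_mult_mem_I_iff: "(\<forall>i. monomial (unit_exp i) * f \<in> I) \<longleftrightarrow> socle_poly f"
proof -
  have "(\<forall>i. \<forall>\<gamma>\<in>\<Lambda> - corn \<Lambda>. lookup (monomial (unit_exp i) * f) \<gamma> = 0) \<longleftrightarrow>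
      (\<forall>\<beta>\<in>\<Lambda> - corn \<Lambda> - precorn \<Lambda>. lookup f \<beta> = 0)" (is "?L \<longleftrightarrow> ?R")
  proof
    assume L: ?L
    show ?R
    proof
      fix \<beta> assume "\<beta> \<in> \<Lambda> - corn \<Lambda> - precorn \<Lambda>"
      \<comment> \<open>A non-corner cell that is not a precorner has a neighbour that is again a
        non-corner cell; multiplying by that x_i exposes the coefficient at
        \<open>\<beta>\<close>.\<close>
      then obtain i where "\<beta> + unit_exp i \<in> \<Lambda> - corn \<Lambda>"
        unfolding precorn_def by blast
      then have "lookup (monomial (unit_exp i) * f) (unit_exp i + \<beta>) = 0"
        using L by (simp add: add.commute)
      then show "lookup f \<beta> = 0" by (simp add: monomial_def lookup_single_mult_add)
    qed
  next
    assume R: ?R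
    show ?L
    proof (intro allI ballI)
      fix i \<gamma> assume \<gamma>: "\<gamma> \<in> \<Lambda> - corn \<Lambda>"
      show "lookup (monomial (unit_exp i) * f) \<gamma> = 0"
      proof (cases "unit_exp i \<le> \<gamma>")
        case True
        then obtain \<beta> where eq: "\<gamma> = unit_exp i + \<beta>" by (auto simp: vec_nat_le_iff_add)
        then have "\<beta> + unit_exp i \<in> \<Lambda> - corn \<Lambda>" using \<gamma> by (simp add: add.commute)
        then have "\<beta> \<notin> precorn \<Lambda>" unfolding precorn_def by blast
        moreover have "\<beta> \<in> \<Lambda>" "\<beta> \<notin> corn \<Lambda>"
          using \<gamma> eq diagram_add_left corn_add_notin[OF _ unit_exp_neq_zero] by auto
        ultimately show ?thesis using R eq by (simp add: monomial_def lookup_single_mult_add)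
      qed (simp add: monomial_def lookup_single_mult_not_le)
    qed
  qed
  \<comment> \<open>Given the first condition, the two sums differ only by cells that are neither
    corner nor precorner, where \<open>f\<close> vanishes.\<close>
  moreover have "b_form (monomial (unit_exp i) * f) = precorn_form i (lookup f)"
    if f: "\<forall>\<beta>\<in>\<Lambda> - corn \<Lambda> - precorn \<Lambda>. lookup f \<beta> = 0" for i
  proof -
    have in_diagram: "\<beta> \<in> \<Lambda> - corn \<Lambda>" if "\<beta> + unit_exp i \<in> corn \<Lambda>" for \<beta>
    proof -
      have "unit_exp i + \<beta> \<in> \<Lambda>" using that by (simp add: corn_def add.commute)
      then show ?thesis using diagram_add_left corn_add_notin[OF _ unit_exp_neq_zero] by blast
    qed
    then have "finite {\<beta>. \<beta> + unit_exp i \<in> corn \<Lambda>}"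
      using finite_diagram by (rule_tac finite_subset[of _ \<Lambda>]) auto
    then show ?thesis
      unfolding b_form_variable_mult precorn_form_def
      by (rule sum.mono_neutral_right) (use f in_diagram in auto)
  qed
  ultimately show ?thesis
    unfolding mem_I_iff socle_poly_def by auto
qed

text \<open>The multipliers sending \<open>f\<close> into the ideal form an ideal themselves, so it
  suffices to test the variables, which generate the maximal ideal.\<close>

lemma cls_mem_socle_iff: "cls f \<in> socle A \<longleftrightarrow> socle_poly f"
proof -
  have "cls f \<in> socle A \<longleftrightarrow> (\<forall>g. lookup g 0 = 0 \<longrightarrow> g * f \<in> I)"
    by (auto simp: socle_def max_ideal_A M0_def carrier_A cls_mult cls_eq_zero_iff mult.commute)
  also have "\<dots> \<longleftrightarrow> (\<forall>i. monomial (unit_exp i) * f \<in> I)"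
  proof
    assume "\<forall>g. lookup g 0 = 0 \<longrightarrow> g * f \<in> I"
    then show "\<forall>i. monomial (unit_exp i) * f \<in> I"
      by (simp add: monomial_def lookup_single unit_exp_neq_zero)
  next
    assume var: "\<forall>i. monomial (unit_exp i) * f \<in> I"
    note closed = ideal_diagram_ideal[unfolded ideal_ring_of_type_algebra_iff]
    show "\<forall>g. lookup g 0 = 0 \<longrightarrow> g * f \<in> I"
    proof (intro allI impI)
      fix g :: "(nat ^ 'k) \<Rightarrow>\<^sub>0 'a" assume "lookup g 0 = 0"
      then have "g \<in> {g. g * f \<in> I}"
        by (rule mem_of_variables[rotated -1])
          (use closed var in \<open>simp_all add: ring_distribs mult.assoc\<close>)
      then show "g * f \<in> I" by simp
    qed
  qed
  finally show ?thesis by (simp add: variable_mult_mem_I_iff)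
qed

section \<open>One-dimensional socles and the Gorenstein criterion\<close>

text \<open>Unfolds the inductive dimension predicate: dimension 1 is a line extension of the zero
  space by a vector outside it.\<close>

lemma dimension_one_iff:
  "ring.dimension A 1 K E \<longleftrightarrow> (\<exists>f. f \<notin> I \<and> E = range (\<lambda>c. cls (const_poly c * f)))"
proof -
  interpret A: cring A by (rule cring_A)
  have line: "A.line_extension K (cls f) {\<zero>\<^bsub>A\<^esub>} = range (\<lambda>c. cls (const_poly c * f))" for f
    by (auto simp: A.line_extension_mem_iff scalars_eq cls_zero cls_mult cls_add)
  show ?thesis
  proof
    assume "A.dimension 1 K E"
    then obtain v E' where v: "v \<in> carrier A" "v \<notin> E'" and E': "A.dimension 0 K E'"
        and E: "E = A.line_extension K v E'"
      by (cases rule: A.dimension.cases) auto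
    have E'_eq: "E' = {\<zero>\<^bsub>A\<^esub>}" using A.dimension_zero[OF subfield_scalars E'] .
    obtain f where f: "v = cls f" using v(1) unfolding carrier_A by (rule rangeE)
    have "f \<notin> I" using v(2) by (simp add: E'_eq f cls_eq_zero_iff)
    moreover have "E = range (\<lambda>c. cls (const_poly c * f))"
      unfolding E E'_eq f by (rule line)
    ultimately
    show "\<exists>f. f \<notin> I \<and> E = range (\<lambda>c. cls (const_poly c * f))" by blast
  next
    assume "\<exists>f. f \<notin> I \<and> E = range (\<lambda>c. cls (const_poly c * f))"
    then obtain f where "f \<notin> I" "E = A.line_extension K (cls f) {\<zero>\<^bsub>A\<^esub>}"
      using line by blast
    then show "A.dimension 1 K E"
      using A.Suc_dim[of "cls f" "{\<zero>\<^bsub>A\<^esub>}" 0 K] by (simp add: carrier_A cls_eq_zero_iff)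
  qed
qed

text \<open>A corner monomial with nonzero constant is always a nonzero socle element. The socle is
  one-dimensional iff it consists of the multiples of this class, that is, iff no socle polynomial
  has a nonzero precorner coefficient.\<close>

lemma gorenstein_iff:
  "gorenstein K A \<longleftrightarrow>
    (\<forall>z. (\<forall>i. precorn_form i z = 0) \<longrightarrow> (\<forall>\<alpha>\<in>precorn \<Lambda>. z \<alpha> = 0))"
proof -
  obtain \<nu> where \<nu>: "\<nu> \<in> corn \<Lambda>" "b \<nu> \<noteq> 0" using b_nonzero by blast
  have precorn_sub: "precorn \<Lambda> \<subseteq> \<Lambda> - corn \<Lambda>" by (auto simp: precorn_def)
  have form_cong: "precorn_form i z = precorn_form i z'"
    if "\<And>\<alpha>. \<alpha> \<in> precorn \<Lambda> \<Longrightarrow> z \<alpha> = z' \<alpha>" for i z z'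
    using that by (simp add: precorn_form_def)
  have form_zero: "precorn_form i z = 0" if "\<And>\<alpha>. \<alpha> \<in> precorn \<Lambda> \<Longrightarrow> z \<alpha> = 0" for i z
    using that by (simp add: precorn_form_def)
  have corner_I: "monomial \<nu> \<notin> I"
    using \<nu> by (simp add: mem_I_iff monomial_def b_form_single)
  have corner_coef: "lookup (monomial \<nu>) \<alpha> = (0 :: 'a)" if "\<alpha> \<in> \<Lambda> - corn \<Lambda>" for \<alpha>
    using that \<nu>(1) by (auto simp: monomial_def lookup_single when_def)
  have corner_socle: "socle_poly (const_poly c * monomial \<nu>)" for c
    unfolding socle_poly_def using precorn_sub
    by (auto intro!: form_zero simp: coef_const_mult corner_coef subset_iff)
  have "ring.dimension A 1 K (socle A) \<longleftrightarrow>
    (\<forall>z. (\<forall>i. precorn_form i z = 0) \<longrightarrow> (\<forall>\<alpha>\<in>precorn \<Lambda>. z \<alpha> = 0))"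
  proof
    assume "ring.dimension A 1 K (socle A)"
    then obtain g where g: "g \<notin> I" and soc: "socle A = range (\<lambda>c. cls (const_poly c * g))"
      unfolding dimension_one_iff by blast
    \<comment> \<open>Every socle class is a multiple of \<open>g\<close>, and the corner monomial
      is one with nonzero factor \<open>d\<close>. Hence \<open>g\<close> inherits the vanishing at
      non-corner cells from that monomial and passes it on to \<open>f\<close>.\<close>
    have coef_zero: "lookup f \<alpha> = 0"
      if "socle_poly f" "\<alpha> \<in> precorn \<Lambda>" for f \<alpha>
    proof -
      have "cls f \<in> socle A" "cls (monomial \<nu>) \<in> socle A"
        using that(1) corner_socle[of 1] by (simp_all add: cls_mem_socle_iff const_poly_def)
      then obtain c d where c: "f - const_poly c * g \<in> I" and d: "monomial \<nu> - const_poly d * g \<in> I"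
        unfolding soc cls_eq_iff[symmetric] by blast
      have "d \<noteq> 0" using d corner_I by (auto simp: const_poly_def)
      have \<alpha>: "\<alpha> \<in> \<Lambda> - corn \<Lambda>" using that(2) precorn_sub by blast
      then have "lookup (monomial \<nu> - const_poly d * g) \<alpha> = 0" "lookup (f - const_poly c * g) \<alpha> = 0"
        using c d by (simp_all add: mem_I_iff)
      then show ?thesis
        using \<open>d \<noteq> 0\<close> corner_coef[OF \<alpha>] by (simp add: lookup_minus coef_const_mult)
    qed
    show "\<forall>z. (\<forall>i. precorn_form i z = 0) \<longrightarrow> (\<forall>\<alpha>\<in>precorn \<Lambda>. z \<alpha> = 0)"
    proof (intro allI impI ballI)
      fix z \<alpha> assume z: "\<forall>i. precorn_form i z = 0" and \<alpha>: "\<alpha> \<in> precorn \<Lambda>"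
      have fin: "finite (precorn \<Lambda>)" using precorn_sub finite_diagram finite_subset by blast
      \<comment> \<open>A solution \<open>z\<close> becomes a socle polynomial when its values are
        taken as coefficients at precorner cells, with 0 elsewhere.\<close>
      define f where "f = (\<Sum>\<alpha>\<in>precorn \<Lambda>. single \<alpha> (z \<alpha>))"
      have f: "lookup f \<beta> = (if \<beta> \<in> precorn \<Lambda> then z \<beta> else 0)" for \<beta>
        using fin by (simp add: f_def lookup_sum lookup_single when_def)
      then have "precorn_form i (lookup f) = 0" for i
        using form_cong[of "lookup f" z i] z by simp
      then have "socle_poly f" by (simp add: socle_poly_def f)
      from coef_zero[OF this \<alpha>] show "z \<alpha> = 0" using \<alpha> by (simp add: f)
    qed
  next
    assume only_zero: "\<forall>z. (\<forall>i. precorn_form i z = 0) \<longrightarrow> (\<forall>\<alpha>\<in>precorn \<Lambda>. z \<alpha> = 0)"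
    have "socle A = range (\<lambda>c. cls (const_poly c * monomial \<nu>))"
    proof (rule subset_antisym)
      show "range (\<lambda>c. cls (const_poly c * monomial \<nu>)) \<subseteq> socle A"
        using corner_socle cls_mem_socle_iff by blast
      show "socle A \<subseteq> range (\<lambda>c. cls (const_poly c * monomial \<nu>))"
      proof
        fix a assume a: "a \<in> socle A"
        then obtain f where f: "a = cls f" by (auto simp: socle_def carrier_A)
        with a have soc: "socle_poly f" by (simp add: cls_mem_socle_iff)
        \<comment> \<open>The precorner coefficients of a socle polynomial solve the system, so they
          are zero.\<close>
        then have "lookup f \<alpha> = 0" if "\<alpha> \<in> precorn \<Lambda>" for \<alpha>
          using only_zero that by (simp add: socle_poly_def)
        with soc have noncorner_zero: "lookup f \<alpha> = 0" if "\<alpha> \<in> \<Lambda> - corn \<Lambda>" for \<alpha>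
          using that unfolding socle_poly_def by blast
        \<comment> \<open>This correction at \<open>\<nu>\<close> makes the corner functional
          vanish, so \<open>f\<close> is congruent to a multiple of the corner monomial.\<close>
        let ?m = "single \<nu> (- (b_form f / b \<nu>))"
        have "f + ?m \<in> I"
          using \<nu> by (auto simp: mem_I_iff lookup_add noncorner_zero lookup_single when_def b_form_add b_form_single)
        moreover have "f + ?m = f - const_poly (b_form f / b \<nu>) * monomial \<nu>"
          by (simp add: const_poly_def monomial_def mult_single single_uminus)
        ultimately show "a \<in> range (\<lambda>c. cls (const_poly c * monomial \<nu>))"
          by (auto simp: f cls_eq_iff)
      qed
    qed
    then show "ring.dimension A 1 K (socle A)"
      unfolding dimension_one_iff using corner_I by blast
  qed
  then show ?thesis by (simp add: gorenstein_def local_algebra_A)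
qed

end

theorem mainTheorem5:
  fixes \<Lambda> :: "(nat ^ 'k::finite) set"
    and b :: "nat ^ 'k \<Rightarrow> 'a::{alg_closed_field, field_char_0}"
  assumes "young_diagram \<Lambda>"
    and "\<exists>\<mu>\<in>corn \<Lambda>. b \<mu> \<noteq> 0"
  shows "gorenstein (diagram_scalars \<Lambda> b) (diagram_algebra \<Lambda> b) \<longleftrightarrow>
    (\<forall>z :: nat ^ 'k \<Rightarrow> 'a.
       (\<forall>i. (\<Sum>\<alpha> | \<alpha> \<in> precorn \<Lambda> \<and> \<alpha> + unit_exp i \<in> corn \<Lambda>.
               b (\<alpha> + unit_exp i) * z \<alpha>) = 0)
       \<longrightarrow> (\<forall>\<alpha>\<in>precorn \<Lambda>. z \<alpha> = 0))"
proof -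
  interpret diagram \<Lambda> b using assms by (rule diagram.intro)
  show ?thesis using gorenstein_iff unfolding precorn_form_def .
qed

end
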